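(* For any Bell scenario, i.e. any finite nonempty sets $S,T,A,B$, with $N=|S||A|+|T||B|$, one has $\mathrm{Corr}(\mathcal{DNN}^N)\subseteq \mathrm{NPA}^{(1)}$.
   Context: $\mathcal{P}$ is the set of vectors $p=(p(a,b|s,t))_{a\in A,b\in B,s\in S,t\in T}$ with $p(a,b|s,t)\ge 0$ and $\sum_{a,b}p(a,b|s,t)=1$ for all $s,t$. $\mathcal{NS}$ is the set of $p\in\mathcal P$ with $\sum_b p(a,b|s,t)=\sum_b p(a,b|s,t')$ for all $a,s$, $t\neq t'$, and $\sum_a p(a,b|s,t)=\sum_a p(a,b|s',t)$ for all $b,t$, $s\ne s'$. For $p\in\mathcal{NS}$ the marginals $p_A(a|s):=\sum_b p(a,b|s,t)$ (any $t$) and $p_B(b|t):=\sum_a p(a,b|s,t)$ (any $s$) are well defined; let $p_A=(p_A(a|s))_{(s,a)}\in\mathbb R^{|S\times A|}$ and $p_B=(p_B(b|t))_{(t,b)}\in\mathbb R^{|T\times B|}$. $\mathcal S^n$ is the space of real symmetric $n\times n$ matrices, $\mathcal S^n_+$ the positive semidefinite ones, and $\mathcal{DNN}^n$ the set of matrices in $\mathcal S^n_+$ with all entries nonnegative. Matrices in $\mathcal S^N$ are indexed by the disjoint union of $S\times A$ and $T\times B$ (in $S\cup T$ the sets $S,T$ are regarded as disjoint). For $i,j\in S\cup T$, $\langle J_{i,j},X\rangle:=\sum_{k,l}X[(i,k),(j,l)]$ is the sum of entries in the $(i,j)$ block ($k\in A$ if $i\in S$, $k\in B$ if $i\in T$;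 likewise $l$ and $j$). $\mathrm{Corr}(\mathcal{DNN}^N)$ is the set of vectors $p\in\mathbb{R}^{|A\times B\times S\times T|}$ for which there is $X\in\mathcal{DNN}^N$ with $\langle J_{i,j},X\rangle=1$ for all $i,j\in S\cup T$ and $X[(s,a),(t,b)]=p(a,b|s,t)$ for all $a,b,s,t$. $\mathrm{NPA}^{(1)}$ (first level of the Navascués–Pironio–Acín hierarchy) is the set of $p\in\mathcal{NS}$ for which, with $P$ the $|S\times A|\times|T\times B|$ matrix $P[(s,a),(t,b)]=p(a,b|s,t)$, there exist symmetric $X$ (indexed by $S\times A$) and $Y$ (indexed by $T\times B$) such that $$\begin{pmatrix}1&p_A^{\mathsf T}&p_B^{\mathsf T}\\ p_A&X&P\\ p_B&P^{\mathsf T}&Y\end{pmatrix}\in\mathcal S_+^{1+N},$$ $X[(s,a),(s,a')]=\delta_{a,a'}\,p_A(a|s)$ for all $s\in S$, $a,a'\in A$, and $Y[(t,b),(t,b')]=\delta_{b,b'}\,p_B(b|t)$ for all $t\in T$, $b,b'\in B$. *)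

theory Defs
  imports "HOL-Analysis.Analysis"
begin

text \<open>
  The finite nonempty sets $S$, $T$, $A$, $B$ of a Bell scenario are rendered as types
  \<^typ>\<open>'s\<close>, \<^typ>\<open>'t\<close>, \<^typ>\<open>'a\<close>, \<^typ>\<open>'b\<close> of class \<^class>\<open>finite\<close>.
  The conditional probability $p(a,b|s,t)$ is the component \<open>p $ (a, b, s, t)\<close>.
\<close>

type_synonym ('s, 't, 'a, 'b) correlation = "real ^ ('a \<times> 'b \<times> 's \<times> 't)"

type_synonym 'n sqmatrix = "real ^ 'n ^ 'n"

type_synonym ('s, 't, 'a, 'b) idx = "('s \<times> 'a) + ('t \<times> 'b)"

lemma CARD_idx:
  "CARD(('s::finite, 't::finite, 'a::finite, 'b::finite) idx)
     = CARD('s) * CARD('a) + CARD('t) * CARD('b)"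
  by (simp add: card_UNIV_sum)

section \<open>Correlations\<close>

definition Prob :: "('s::finite, 't::finite, 'a::finite, 'b::finite) correlation set" where
  "Prob = {p. (\<forall>a b s t. 0 \<le> p $ (a, b, s, t)) \<and>
              (\<forall>s t. (\<Sum>a\<in>UNIV. \<Sum>b\<in>UNIV. p $ (a, b, s, t)) = 1)}"

definition NS :: "('s::finite, 't::finite, 'a::finite, 'b::finite) correlation set" where
  "NS = {p \<in> Prob.
     (\<forall>a s t t'. t \<noteq> t' \<longrightarrow>
        (\<Sum>b\<in>UNIV. p $ (a, b, s, t)) = (\<Sum>b\<in>UNIV. p $ (a, b, s, t'))) \<and>
     (\<forall>b t s s'. s \<noteq> s' \<longrightarrow>
        (\<Sum>a\<in>UNIV. p $ (a, b, s, t)) = (\<Sum>a\<in>UNIV. p $ (a, b, s', t)))}"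

text \<open>The marginals are evaluated at an arbitrary input of the other party; on \<open>NS\<close> the
  choice is irrelevant, see \<open>marginal_A_eq\<close> and \<open>marginal_B_eq\<close>.\<close>

definition marginal_A ::
    "('s::finite, 't::finite, 'a::finite, 'b::finite) correlation \<Rightarrow> real ^ ('s \<times> 'a)" where
  "marginal_A p = vec_lambda (\<lambda>(s, a). \<Sum>b\<in>UNIV. p $ (a, b, s, (SOME t. True)))"

definition marginal_B ::
    "('s::finite, 't::finite, 'a::finite, 'b::finite) correlation \<Rightarrow> real ^ ('t \<times> 'b)" where
  "marginal_B p = vec_lambda (\<lambda>(t, b). \<Sum>a\<in>UNIV. p $ (a, b, (SOME s. True), t))"

lemma marginal_A_eq:
  assumes "p \<in> NS"
  shows "marginal_A p $ (s, a) = (\<Sum>b\<in>UNIV. p $ (a, b, s, t))"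
proof (cases "t = (SOME t. True)")
  case False
  then show ?thesis using assms unfolding NS_def marginal_A_def by simp
qed (simp add: marginal_A_def)

lemma marginal_B_eq:
  assumes "p \<in> NS"
  shows "marginal_B p $ (t, b) = (\<Sum>a\<in>UNIV. p $ (a, b, s, t))"
proof (cases "s = (SOME s. True)")
  case False
  then show ?thesis using assms unfolding NS_def marginal_B_def by simp
qed (simp add: marginal_B_def)

section \<open>Matrix cones\<close>

definition Sym :: "('n::finite) sqmatrix set" where
  "Sym = {X. transpose X = X}"

definition PSD :: "('n::finite) sqmatrix set" where
  "PSD = {X \<in> Sym. \<forall>v. 0 \<le> v \<bullet> (X *v v)}"

definition DNN :: "('n::finite) sqmatrix set" where
  "DNN = {X \<in> PSD. \<forall>i j. 0 \<le> X $ i $ j}"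

section \<open>Correlations induced by a matrix cone\<close>

text \<open>Indices belonging to a given input in $S \cup T$ (disjoint union).\<close>

definition block :: "'s + 't \<Rightarrow> ('s, 't, 'a, 'b) idx set" where
  "block i = (case i of Inl s \<Rightarrow> {Inl (s, k) | k. True} | Inr t \<Rightarrow> {Inr (t, k) | k. True})"

text \<open>\<open>block_sum i j X\<close> is $\langle J_{i,j}, X\rangle$.\<close>

definition block_sum ::
    "'s + 't \<Rightarrow> 's + 't \<Rightarrow> ('s::finite, 't::finite, 'a::finite, 'b::finite) idx sqmatrix \<Rightarrow> real" where
  "block_sum i j X = (\<Sum>k\<in>block i. \<Sum>l\<in>block j. X $ k $ l)"

definition Corr ::
    "('s::finite, 't::finite, 'a::finite, 'b::finite) idx sqmatrix set
       \<Rightarrow> ('s, 't, 'a, 'b) correlation set" where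
  "Corr K = {p. \<exists>X\<in>K. (\<forall>i j. block_sum i j X = 1) \<and>
                  (\<forall>a b s t. X $ Inl (s, a) $ Inr (t, b) = p $ (a, b, s, t))}"

section \<open>First level of the Navascues-Pironio-Acin hierarchy\<close>

definition corr_matrix ::
    "('s::finite, 't::finite, 'a::finite, 'b::finite) correlation \<Rightarrow> real ^ ('t \<times> 'b) ^ ('s \<times> 'a)" where
  "corr_matrix p = vec_lambda (\<lambda>(s, a). vec_lambda (\<lambda>(t, b). p $ (a, b, s, t)))"

text \<open>The symmetric $3 \times 3$ block matrix with rows $(1, u^T, v^T)$, $(u, X, P)$,
  $(v, P^T, Y)$.\<close>

fun bordered_entry ::
    "real ^ 'm \<Rightarrow> real ^ 'n \<Rightarrow> 'm sqmatrix \<Rightarrow> real ^ 'n ^ 'm \<Rightarrow> 'n sqmatrix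
       \<Rightarrow> unit + ('m + 'n) \<Rightarrow> unit + ('m + 'n) \<Rightarrow> real" where
  "bordered_entry u v X P Y (Inl _) (Inl _) = 1"
| "bordered_entry u v X P Y (Inl _) (Inr (Inl j)) = u $ j"
| "bordered_entry u v X P Y (Inl _) (Inr (Inr j)) = v $ j"
| "bordered_entry u v X P Y (Inr (Inl i)) (Inl _) = u $ i"
| "bordered_entry u v X P Y (Inr (Inl i)) (Inr (Inl j)) = X $ i $ j"
| "bordered_entry u v X P Y (Inr (Inl i)) (Inr (Inr j)) = P $ i $ j"
| "bordered_entry u v X P Y (Inr (Inr i)) (Inl _) = v $ i"
| "bordered_entry u v X P Y (Inr (Inr i)) (Inr (Inl j)) = transpose P $ i $ j"
| "bordered_entry u v X P Y (Inr (Inr i)) (Inr (Inr j)) = Y $ i $ j"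

definition bordered_matrix ::
    "real ^ ('m::finite) \<Rightarrow> real ^ ('n::finite) \<Rightarrow> 'm sqmatrix \<Rightarrow> real ^ 'n ^ 'm \<Rightarrow> 'n sqmatrix
       \<Rightarrow> (unit + ('m + 'n)) sqmatrix" where
  "bordered_matrix u v X P Y = (\<chi> i j. bordered_entry u v X P Y i j)"

definition NPA1 :: "('s::finite, 't::finite, 'a::finite, 'b::finite) correlation set" where
  "NPA1 = {p \<in> NS. \<exists>X\<in>Sym. \<exists>Y\<in>Sym.
     bordered_matrix (marginal_A p) (marginal_B p) X (corr_matrix p) Y \<in> PSD \<and>
     (\<forall>s a a'. X $ (s, a) $ (s, a') = (if a = a' then marginal_A p $ (s, a) else 0)) \<and>
     (\<forall>t b b'. Y $ (t, b) $ (t, b') = (if b = b' then marginal_B p $ (t, b) else 0))}"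

end

(* The indicator vectors e_i of the blocks satisfy (e_i - e_j)^T Z (e_i - e_j) = 1 - 2 + 1 = 0, so
   u = Z e_i does not depend on i; this is no-signalling, with the marginals as entries of u, and
   the matrix Z bordered by u has the form (x + c e_i)^T Z (x + c e_i), hence is positive
   semidefinite.  Replacing the diagonal blocks of Z by diagonal matrices with the same row sums
   adds the Laplacian of a nonnegatively weighted graph, which is again positive semidefinite. *)
theory Submission
  imports Defs
begin

lemma PSD_inner_commute:
  assumes "Z \<in> PSD"
  shows "x \<bullet> (Z *v y) = y \<bullet> (Z *v x)"
proof -
  have "transpose Z = Z"
    using assms by (simp add: PSD_def Sym_def)
  then have "x \<bullet> (Z *v y) = (Z *v x) \<bullet> y"
    by (metis dot_lmul_matrix vector_transpose_matrix)
  then show ?thesis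
    by (simp add: inner_commute)
qed

lemma PSD_quadratic_expand:
  assumes "Z \<in> PSD"
  shows "(x + c *\<^sub>R y) \<bullet> (Z *v (x + c *\<^sub>R y))
           = x \<bullet> (Z *v x) + 2 * c * (x \<bullet> (Z *v y)) + c\<^sup>2 * (y \<bullet> (Z *v y))"
  using PSD_inner_commute[OF assms, of y x]
  by (simp add: matrix_vector_right_distrib matrix_vector_mult_scaleR inner_add_left
      inner_add_right power2_eq_square algebra_simps)

text \<open>Otherwise the form, which vanishes at \<open>x\<close>, would decrease to first order in
  the direction \<open>- (Z *v x)\<close>, and a small step that way would make it negative.\<close>

lemma PSD_null_vector:
  assumes Z: "Z \<in> PSD" and null: "x \<bullet> (Z *v x) = 0"
  shows "Z *v x = 0"
proof (rule ccontr)
  define w where "w = Z *v x"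
  define c where "c = w \<bullet> (Z *v w)"
  define d where "d = w \<bullet> w"
  assume "Z *v x \<noteq> 0"
  then have d: "d > 0"
    by (simp add: d_def w_def)
  have c: "c \<ge> 0"
    using Z by (simp add: PSD_def c_def)
  \<comment> \<open>The \<open>+ 1\<close> covers \<open>c = 0\<close> and yields
    \<open>r * c = - d - r\<close>, so the form equals \<open>r * (d - r)\<close> with
    \<open>r\<close> negative and \<open>d\<close> positive.\<close>
  define r where "r = - d / (c + 1)"
  have "0 \<le> (x + r *\<^sub>R w) \<bullet> (Z *v (x + r *\<^sub>R w))"
    using Z unfolding PSD_def by blast
  also have "\<dots> = 2 * r * d + r\<^sup>2 * c"
    using null PSD_inner_commute[OF Z, of x w]
    by (simp add: PSD_quadratic_expand[OF Z] c_def d_def w_def)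
  also have "\<dots> = r * (2 * d + r * c)"
    by (simp add: power2_eq_square algebra_simps)
  also have "r * c = - d - r"
    using c by (simp add: r_def field_simps)
  also have "r * (2 * d + (- d - r)) < 0"
    using c d by (intro mult_neg_pos) (auto simp: r_def divide_neg_pos add_pos_pos)
  finally show False by simp
qed

text \<open>The right side minus the left side is half the sum of
  \<open>w k l * (x k - x l)\<^sup>2\<close>, the Laplacian form of the graph with weights
  \<open>w\<close>.\<close>

lemma quadratic_form_le_row_sums:
  fixes w :: "'n::finite \<Rightarrow> 'n \<Rightarrow> real"
  assumes nonneg: "\<And>k l. 0 \<le> w k l" and sym: "\<And>k l. w k l = w l k"
  shows "(\<Sum>k\<in>UNIV. \<Sum>l\<in>UNIV. x k * w k l * x l)
           \<le> (\<Sum>k\<in>UNIV. (\<Sum>l\<in>UNIV. w k l) * (x k)\<^sup>2)"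
proof -
  have "0 \<le> (\<Sum>k\<in>UNIV. \<Sum>l\<in>UNIV. w k l * (x k - x l)\<^sup>2)"
    by (intro sum_nonneg mult_nonneg_nonneg nonneg) simp
  also have "\<dots> = (\<Sum>k\<in>UNIV. \<Sum>l\<in>UNIV. w k l * (x k)\<^sup>2)
      + (\<Sum>k\<in>UNIV. \<Sum>l\<in>UNIV. w k l * (x l)\<^sup>2)
      - 2 * (\<Sum>k\<in>UNIV. \<Sum>l\<in>UNIV. x k * w k l * x l)"
    by (simp add: sum.distrib sum_subtractf sum_distrib_left power2_eq_square algebra_simps)
  also have "(\<Sum>k\<in>UNIV. \<Sum>l\<in>UNIV. w k l * (x l)\<^sup>2)
      = (\<Sum>k\<in>UNIV. \<Sum>l\<in>UNIV. w k l * (x k)\<^sup>2)"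
    by (subst sum.swap) (simp add: sym)
  finally show ?thesis
    by (simp add: sum_distrib_right)
qed

lemma sum_UNIV_Plus:
  "(\<Sum>i\<in>(UNIV :: ('a::finite + 'b::finite) set). f i)
     = (\<Sum>i\<in>UNIV. f (Inl i)) + (\<Sum>i\<in>UNIV. f (Inr i))"
  unfolding UNIV_Plus_UNIV[symmetric] by (subst sum.Plus) (auto simp: comp_def)

lemma inner_matrix_vector_sum:
  fixes M :: "'n::finite sqmatrix"
  shows "x \<bullet> (M *v y) = (\<Sum>k\<in>UNIV. \<Sum>l\<in>UNIV. x $ k * M $ k $ l * y $ l)"
  by (simp add: inner_vec_def matrix_vector_mult_def sum_distrib_left mult.assoc)

text \<open>On a vector split into a first coordinate \<open>c\<close> and a rest \<open>x\<close>,
  the bordered form is exactly the expression in \<open>q\<close>. This confines the case analysis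
  on indices to one place.\<close>

lemma bordered_matrix_in_PSD:
  fixes u :: "real ^ 'm::finite" and v :: "real ^ 'n::finite" and W :: "('m + 'n) sqmatrix"
  assumes sym: "W \<in> Sym"
    and X: "\<And>i j. X $ i $ j = W $ Inl i $ Inl j"
    and P: "\<And>i j. P $ i $ j = W $ Inl i $ Inr j"
    and Y: "\<And>i j. Y $ i $ j = W $ Inr i $ Inr j"
    and q: "\<And>(c::real) x. 0 \<le> c\<^sup>2 + 2 * c * ((\<Sum>i\<in>UNIV. u $ i * x $ Inl i)
              + (\<Sum>j\<in>UNIV. v $ j * x $ Inr j)) + x \<bullet> (W *v x)"
  shows "bordered_matrix u v X P Y \<in> PSD"
proof -
  have W: "W $ k $ l = W $ l $ k" for k l
    using sym by (simp add: Sym_def transpose_def vec_eq_iff)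
  have entry: "bordered_entry u v X P Y (Inr k) (Inr l) = W $ k $ l" for k l
    by (cases k; cases l) (simp_all add: X P Y transpose_def W[of "Inl _" "Inr _"])
  have border: "bordered_entry u v X P Y (Inr k) (Inl c) = bordered_entry u v X P Y (Inl c) (Inr k)"
    for k c
    by (cases k) simp_all
  have "bordered_entry u v X P Y k l = bordered_entry u v X P Y l k" for k l
    by (cases k; cases l) (simp_all add: entry border W)
  then have "bordered_matrix u v X P Y \<in> Sym"
    by (simp add: Sym_def transpose_def bordered_matrix_def vec_eq_iff)
  moreover have "0 \<le> z \<bullet> (bordered_matrix u v X P Y *v z)" for z
  proof -
    define x where "x = (\<chi> k. z $ Inr k)"
    have "z \<bullet> (bordered_matrix u v X P Y *v z)
        = (z $ Inl ())\<^sup>2 + 2 * (\<Sum>k\<in>UNIV. z $ Inl () * bordered_entry u v X P Y (Inl ()) (Inr k) * x $ k)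
          + x \<bullet> (W *v x)"
      unfolding inner_matrix_vector_sum
      \<comment> \<open>Only the border is split off here: the type instance keeps the sums over
        \<open>'m + 'n\<close> whole, so that \<open>entry\<close> can turn them into the form of
        \<open>W\<close>.\<close>
      by (simp only: sum_UNIV_Plus[where ?'a = unit])
        (simp add: UNIV_unit bordered_matrix_def entry border sum.distrib x_def power2_eq_square
          mult.commute mult.left_commute)
    also have "\<dots> = (z $ Inl ())\<^sup>2 + 2 * z $ Inl () * ((\<Sum>i\<in>UNIV. u $ i * x $ Inl i)
              + (\<Sum>j\<in>UNIV. v $ j * x $ Inr j)) + x \<bullet> (W *v x)"
      by (simp add: sum_UNIV_Plus sum_distrib_left algebra_simps)
    finally show ?thesis
      using q[of "z $ Inl ()" x] by simp
  qed
  ultimately show ?thesis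
    by (simp add: PSD_def)
qed

text \<open>Turns "lying in the same block" into an equation between indices.\<close>

fun input :: "('s, 't, 'a, 'b) idx \<Rightarrow> 's + 't" where
  "input (Inl (s, a)) = Inl s"
| "input (Inr (t, b)) = Inr t"

lemma mem_block_iff: "k \<in> block i \<longleftrightarrow> input k = i"
  by (cases k rule: input.cases; cases i) (auto simp: block_def)

lemma sum_block_Inl: "sum f (block (Inl s)) = (\<Sum>a\<in>UNIV. f (Inl (s, a)))"
  by (rule sum.reindex_bij_witness[of _ "\<lambda>a. Inl (s, a)" "\<lambda>x. snd (projl x)"])
    (auto simp: block_def)

lemma sum_block_Inr: "sum f (block (Inr t)) = (\<Sum>b\<in>UNIV. f (Inr (t, b)))"
  by (rule sum.reindex_bij_witness[of _ "\<lambda>b. Inr (t, b)" "\<lambda>x. snd (projr x)"])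
    (auto simp: block_def)

definition block_indicator ::
    "'s + 't \<Rightarrow> real ^ ('s::finite, 't::finite, 'a::finite, 'b::finite) idx" where
  "block_indicator i = (\<chi> k. if k \<in> block i then 1 else 0)"

lemma matrix_mult_block_indicator:
  "(Z *v block_indicator i) $ k = (\<Sum>l\<in>block i. Z $ k $ l)"
  by (simp add: matrix_vector_mult_def block_indicator_def if_distrib sum.If_cases cong: if_cong)

lemma inner_block_indicator:
  "block_indicator i \<bullet> x = (\<Sum>k\<in>block i. x $ k)"
  by (simp add: inner_vec_def block_indicator_def if_distrib[where f = "\<lambda>c. c * _"] sum.If_cases
      cong: if_cong)

lemma block_indicator_quadratic:
  "block_indicator i \<bullet> (Z *v block_indicator j) = block_sum i j Z"
  by (simp add: inner_block_indicator matrix_mult_block_indicator block_sum_def)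

text \<open>Two block indicators differ by a kernel vector of \<open>Z\<close>. For blocks of the
  other party this becomes no-signalling; for the block of \<open>k\<close> itself it gives the row
  sums of the diagonal blocks.\<close>

lemma block_row_sum_eq:
  fixes Z :: "('s::finite, 't::finite, 'a::finite, 'b::finite) idx sqmatrix"
  assumes Z: "Z \<in> PSD" and one: "\<And>i j. block_sum i j Z = 1"
  shows "(\<Sum>l\<in>block i. Z $ k $ l) = (\<Sum>l\<in>block j. Z $ k $ l)"
proof -
  define x :: "real ^ ('s, 't, 'a, 'b) idx" where
    \<comment> \<open>The difference is written in this form to match
      \<open>PSD_quadratic_expand\<close> with \<open>c = -1\<close>.\<close>
    "x = block_indicator i + (-1) *\<^sub>R block_indicator j"
  have "x \<bullet> (Z *v x) = 0"
    unfolding x_def PSD_quadratic_expand[OF Z] block_indicator_quadratic one by simp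
  then have "Z *v x = 0"
    by (rule PSD_null_vector[OF Z])
  then have "Z *v block_indicator i = Z *v block_indicator j"
    by (simp add: x_def matrix_vector_mult_diff_distrib)
  then show ?thesis
    by (simp flip: matrix_mult_block_indicator)
qed

theorem mainTheorem2:
  shows "Corr (DNN :: ('s::finite, 't::finite, 'a::finite, 'b::finite) idx sqmatrix set)
           \<subseteq> (NPA1 :: ('s, 't, 'a, 'b) correlation set)"
proof
  fix p :: "('s, 't, 'a, 'b) correlation"
  assume "p \<in> Corr DNN"
  then obtain Z :: "('s, 't, 'a, 'b) idx sqmatrix" where
    Z: "Z \<in> PSD" and nonneg: "\<And>k l. 0 \<le> Z $ k $ l" and one: "\<And>i j. block_sum i j Z = 1"
    and Zp: "\<And>a b s t. Z $ Inl (s, a) $ Inr (t, b) = p $ (a, b, s, t)"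
    unfolding Corr_def DNN_def by blast
  have Zsym: "Z $ k $ l = Z $ l $ k" for k l
    using Z by (simp add: PSD_def Sym_def transpose_def vec_eq_iff)
  \<comment> \<open>The choice of block is arbitrary: by \<open>block_row_sum_eq\<close> every block
    leads to the same \<open>u\<close>.\<close>
  define e :: "real ^ ('s, 't, 'a, 'b) idx" where "e = block_indicator (Inl undefined)"
  define u where "u = Z *v e"
  have u: "(\<Sum>l\<in>block i. Z $ k $ l) = u $ k" for i k
    unfolding u_def e_def matrix_mult_block_indicator by (rule block_row_sum_eq[OF Z one])
  \<comment> \<open>The right side does not mention \<open>t\<close>, which is no-signalling towards
    the first party.\<close>
  have uA: "(\<Sum>b\<in>UNIV. p $ (a, b, s, t)) = u $ Inl (s, a)" for a s t
    using u[of "Inl (s, a)" "Inr t"] by (simp add: sum_block_Inr Zp)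
  have uB: "(\<Sum>a\<in>UNIV. p $ (a, b, s, t)) = u $ Inr (t, b)" for b s t
    using u[of "Inr (t, b)" "Inl s"] by (simp add: sum_block_Inl Zsym[of "Inr _"] Zp)
  have "(\<Sum>a\<in>UNIV. \<Sum>b\<in>UNIV. p $ (a, b, s, t)) = 1" for s t
    using one[of "Inl s" "Inr t"] by (simp add: block_sum_def sum_block_Inl sum_block_Inr Zp)
  moreover have "0 \<le> p $ (a, b, s, t)" for a b s t
    using nonneg[of "Inl (s, a)" "Inr (t, b)"] by (simp add: Zp)
  ultimately have NS: "p \<in> NS"
    by (simp add: NS_def Prob_def uA uB)
  have mA: "marginal_A p $ i = u $ Inl i" for i
    by (cases i) (simp add: marginal_A_def uA)
  have mB: "marginal_B p $ j = u $ Inr j" for j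
    by (cases j) (simp add: marginal_B_def uB)

  \<comment> \<open>\<open>w\<close> is the block-diagonal part of \<open>Z\<close>. By
    \<open>w_row\<close> below, \<open>W - Z\<close> is the Laplacian of the graph with weights
    \<open>w\<close>; the blocks of \<open>Z\<close> off the diagonal, among them
    \<open>corr_matrix p\<close>, stay as they are.\<close>
  define w where "w k l = (if input k = input l then Z $ k $ l else 0)" for k l
  define W :: "('s, 't, 'a, 'b) idx sqmatrix" where
    "W = (\<chi> k l. (if k = l then u $ k else 0) + Z $ k $ l - w k l)"
  define X :: "('s \<times> 'a) sqmatrix" where "X = (\<chi> i j. W $ Inl i $ Inl j)"
  define Y :: "('t \<times> 'b) sqmatrix" where "Y = (\<chi> i j. W $ Inr i $ Inr j)"
  have wsym: "w k l = w l k" for k l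
    by (simp add: w_def Zsym)
  have w_row: "(\<Sum>l\<in>UNIV. w k l) = u $ k" for k
  proof -
    have "(\<Sum>l\<in>UNIV. w k l) = (\<Sum>l\<in>block (input k). Z $ k $ l)"
      unfolding w_def by (rule sum.mono_neutral_cong_right) (auto simp: mem_block_iff)
    then show ?thesis
      by (simp add: u)
  qed
  have Wsym: "W \<in> Sym"
    by (simp add: Sym_def W_def transpose_def vec_eq_iff wsym Zsym)
  have W_ge: "x \<bullet> (Z *v x) \<le> x \<bullet> (W *v x)" for x
  proof -
    have diag: "(\<Sum>l\<in>UNIV. x $ k * (if k = l then u $ k else 0) * x $ l) = u $ k * (x $ k)\<^sup>2" for k
    proof -
      have "(\<Sum>l\<in>UNIV. x $ k * (if k = l then u $ k else 0) * x $ l)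
          = (\<Sum>l\<in>UNIV. if k = l then u $ k * (x $ k)\<^sup>2 else 0)"
        by (rule sum.cong) (auto simp: power2_eq_square)
      then show ?thesis by simp
    qed
    have "x \<bullet> (W *v x) = (\<Sum>k\<in>UNIV. u $ k * (x $ k)\<^sup>2) + x \<bullet> (Z *v x)
        - (\<Sum>k\<in>UNIV. \<Sum>l\<in>UNIV. x $ k * w k l * x $ l)"
      \<comment> \<open>Reading \<open>diag\<close> backwards makes the diagonal term a double sum
        too, so linearity alone finishes.\<close>
      unfolding inner_matrix_vector_sum W_def diag[symmetric]
      by (simp only: vec_lambda_beta ring_distribs sum.distrib sum_subtractf)
    moreover have "(\<Sum>k\<in>UNIV. \<Sum>l\<in>UNIV. x $ k * w k l * x $ l) \<le> (\<Sum>k\<in>UNIV. u $ k * (x $ k)\<^sup>2)"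
      unfolding w_row[symmetric]
      by (rule quadratic_form_le_row_sums) (auto simp: w_def nonneg Zsym)
    ultimately show ?thesis by simp
  qed
  have "bordered_matrix (marginal_A p) (marginal_B p) X (corr_matrix p) Y \<in> PSD"
  proof (rule bordered_matrix_in_PSD[OF Wsym])
    fix c :: real and x :: "real ^ ('s, 't, 'a, 'b) idx"
    have "(\<Sum>i\<in>UNIV. marginal_A p $ i * x $ Inl i) + (\<Sum>j\<in>UNIV. marginal_B p $ j * x $ Inr j) = x \<bullet> u"
      by (simp add: inner_vec_def sum_UNIV_Plus mA mB mult.commute)
    moreover have "0 \<le> c\<^sup>2 + 2 * c * (x \<bullet> u) + x \<bullet> (Z *v x)"
    proof -
      \<comment> \<open>Expanding gives the bordered form with \<open>Z\<close> in place of
        \<open>W\<close>; the corner entry 1 is \<open>e \<bullet> (Z *v e)\<close>. Passing to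
        \<open>W\<close> only increases it, by \<open>W_ge\<close>.\<close>
      have "0 \<le> (x + c *\<^sub>R e) \<bullet> (Z *v (x + c *\<^sub>R e))"
        using Z unfolding PSD_def by blast
      moreover have "e \<bullet> (Z *v e) = 1"
        by (simp add: e_def block_indicator_quadratic one)
      ultimately show ?thesis
        by (simp add: PSD_quadratic_expand[OF Z] u_def)
    qed
    ultimately show "0 \<le> c\<^sup>2 + 2 * c * ((\<Sum>i\<in>UNIV. marginal_A p $ i * x $ Inl i)
              + (\<Sum>j\<in>UNIV. marginal_B p $ j * x $ Inr j)) + x \<bullet> (W *v x)"
      using W_ge[of x] by simp
  qed (auto simp: X_def Y_def W_def w_def corr_matrix_def Zp)
  moreover have "X \<in> Sym" "Y \<in> Sym"
    using Wsym by (simp_all add: Sym_def X_def Y_def transpose_def vec_eq_iff)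
  \<comment> \<open>Inside a diagonal block \<open>Z\<close> and \<open>w\<close> cancel, leaving
    only the diagonal entries of \<open>u\<close>, which are the marginals.\<close>
  moreover have "X $ (s, a) $ (s, a') = (if a = a' then marginal_A p $ (s, a) else 0)" for s a a'
    by (simp add: X_def W_def w_def mA)
  moreover have "Y $ (t, b) $ (t, b') = (if b = b' then marginal_B p $ (t, b) else 0)" for t b b'
    by (simp add: Y_def W_def w_def mB)
  ultimately show "p \<in> NPA1"
    using NS unfolding NPA1_def by blast
qed

end
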